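(* $\mathrm{FAct}(\Phi)=\mathrm{RLP}(\Phi)$: every pointed action model in $\mathrm{FAct}(\Phi)$ is bisimilar to the pointed action model associated with some recursive learning program in $\mathrm{RLP}(\Phi)$, and every recursive learning program in $\mathrm{RLP}(\Phi)$ has as associated pointed action model a finite $K45$ pointed action model.
   Context: Fix a set $A$ of agents, atoms $P$, and a set $\Phi$ of epistemic formulas over $P$ and $A$. An action model $N=\langle S,(\rightharpoonup_a)_{a\in A},pre\rangle$ is $K45$ if each $\rightharpoonup_a$ is transitive and Euclidean. $\mathrm{FAct}(\Phi)$ is the set of pointed action models $(N,t)$ with $N$ finite and $K45$ and preconditions in $\Phi$. Bisimulation: back-and-forth over all agents with related events having $KD45$-equivalent preconditions; $a$-bisimilarity of $(N,s)$, $(N',s')$: each $a$-successor of one actual event is bisimilar to some $a$-successor of the other. $gr((N,s))=\{a:\exists t\ s\rightharpoonup_a t\}$. Terms (with variables $X,Y,\dots$) and attributes $group,pre$ (possibly undefined): a variable $X$ ($group,pre$ undefined); $?\varphi$ ($group=\emptyset$, $pre=\varphi$); $L_B(\alpha_1,\dots,\alpha_n)$, $B\subseteq A$ ($group=B\cup group(\alpha_1)$, $pre=pre(\alpha_1)$ when defined); $\alpha_1\cap\alpha_2$ ($group$ union, $pre=pre(\alpha_1)$, when both groups are defined and disjoint and both pre's are defined and equal); $\psi|_B\alpha_1$ ($group=B$, $pre=\psi$, when $group(\alpha_1)$ is defined and $B\subseteq group(\alpha_1)$); $\mu X_1.\alpha(X_1,\dots,X_k)$ when $group(\alpha)$ and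 $pre(\alpha)$ are defined, binding $X_1$, with the same $group$ and $pre$ as $\alpha$. $\mathrm{RLP}(\Phi)$ is the set of closed terms. Semantics of the constructors on action models: $?\varphi$: one event, empty relations, precondition $\varphi$. $L_B(\alpha_1,\dots,\alpha_k)$ with disjoint models $(N_l,s_l)$: events $\{(s_l,1)\}_l\cup\bigcup_l S_l$; for $b\in B$, $(s_i,1)\rightharpoonup_b(s_j,1)$ iff $(N_i,s_i)$, $(N_j,s_j)$ are $b$-bisimilar; for $a\in gr((N_j,s_j))\setminus B$, $(s_j,1)\rightharpoonup_a t$ whenever $s_j\rightharpoonup^j_a t$; old relations kept; actual event $(s_1,1)$, $pre((s_l,1))=pre_l(s_l)$. $\alpha_1\cap\alpha_2$: a new actual event $s$, $pre(s)=pre(s_1)$, added to the disjoint union; for $a\in group(\alpha_i)$, relations of $N_i$ kept and $s\rightharpoonup_a t$ whenever $s_i\rightharpoonup^i_a t$. $\psi|_B\alpha$: new actual event $s$, $pre(s)=\psi$, added to $N_\alpha$, relations kept, $s\rightharpoonup_b t$ whenever $b\in B$ and $s_\alpha\rightharpoonup_b t$. For a term with free variable $X$, its open action model is built by these clauses with $X$ interpreted as a placeholder pointed model $(N_X,s_X)$ whose precondition and successor sets $a[s_X]=\{t: s_X\rightharpoonup_a t\}$ are indeterminate; substituting a pointed model for $X$ means using its actual event in place of $s_X$. The pointed action model of $\mu X.\alpha(X)$ is obtained from the open action model of $\alpha(X)$ by replacing $s_X$ with the actual event $s_{\alpha(X)}$ of that model (a fixed point: the $a$-successors of $s_X$ become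 those of $s_{\alpha(X)}$, and $pre(s_X)=pre(s_{\alpha(X)})$). *)

theory Defs
  imports "HOL-Library.Countable_Set"
begin

text \<open>Atoms are the elements of type \<open>'p\<close> and agents the elements of type \<open>'a\<close>; neither
  type is assumed finite.\<close>

datatype ('p, 'a) fm =
    Atom 'p
  | Neg "('p, 'a) fm"
  | Conj "('p, 'a) fm" "('p, 'a) fm"
  | Know 'a "('p, 'a) fm"

record ('p, 'a, 'w) kmodel =
  worlds :: "'w set"
  acc :: "'a \<Rightarrow> 'w rel"
  val :: "'p \<Rightarrow> 'w set"

definition euclidean :: "'b rel \<Rightarrow> bool" where
  "euclidean r \<longleftrightarrow> (\<forall>x y z. (x, y) \<in> r \<longrightarrow> (x, z) \<in> r \<longrightarrow> (y, z) \<in> r)"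

definition kd45 :: "('p, 'a, 'w) kmodel \<Rightarrow> bool" where
  "kd45 M \<longleftrightarrow> (\<forall>a. acc M a \<subseteq> worlds M \<times> worlds M \<and>
     (\<forall>w\<in>worlds M. \<exists>v. (w, v) \<in> acc M a) \<and> trans (acc M a) \<and> euclidean (acc M a))"

primrec sat :: "('p, 'a, 'w) kmodel \<Rightarrow> 'w \<Rightarrow> ('p, 'a) fm \<Rightarrow> bool" where
  "sat M w (Atom p) \<longleftrightarrow> w \<in> val M p"
| "sat M w (Neg \<phi>) \<longleftrightarrow> \<not> sat M w \<phi>"
| "sat M w (Conj \<phi> \<psi>) \<longleftrightarrow> sat M w \<phi> \<and> sat M w \<psi>"
| "sat M w (Know a \<phi>) \<longleftrightarrow> (\<forall>v. (w, v) \<in> acc M a \<longrightarrow> sat M v \<phi>)"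

text \<open>Truth in the same pointed KD45 models. The worlds have to be drawn from a fixed type; the
  carrier is an arbitrary subset of it, and by \<open>kd45_equiv_any_type\<close> below the choice of
  \<open>nat\<close> loses nothing.\<close>

definition kd45_equiv :: "('p, 'a) fm \<Rightarrow> ('p, 'a) fm \<Rightarrow> bool" where
  "kd45_equiv \<phi> \<psi> \<longleftrightarrow>
     (\<forall>(M :: ('p, 'a, nat) kmodel) w. kd45 M \<longrightarrow> w \<in> worlds M \<longrightarrow> sat M w \<phi> = sat M w \<psi>)"

primrec subfms :: "('p, 'a) fm \<Rightarrow> ('p, 'a) fm set" where
  "subfms (Atom p) = {Atom p}"
| "subfms (Neg \<phi>) = insert (Neg \<phi>) (subfms \<phi>)"
| "subfms (Conj \<phi> \<psi>) = insert (Conj \<phi> \<psi>) (subfms \<phi> \<union> subfms \<psi>)"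
| "subfms (Know a \<phi>) = insert (Know a \<phi>) (subfms \<phi>)"

lemma finite_subfms: "finite (subfms \<phi>)"
  by (induction \<phi>) auto

lemma subfms_self: "\<phi> \<in> subfms \<phi>"
  by (cases \<phi>) auto

lemma subfms_trans: "\<chi> \<in> subfms \<phi> \<Longrightarrow> subfms \<chi> \<subseteq> subfms \<phi>"
  by (induction \<phi>) auto

lemma kd45_equiv_any_type:
  fixes M :: "('p, 'a, 'w) kmodel"
  assumes eq: "kd45_equiv \<phi> \<psi>" and M: "kd45 M" and w: "w \<in> worlds M"
  shows "sat M w \<phi> = sat M w \<psi>"
proof -
  define Sub where "Sub = subfms \<phi> \<union> subfms \<psi>"
  define F where "F = {a. \<exists>\<chi>. Know a \<chi> \<in> Sub}"
  define h where "h = (\<lambda>u (a, \<chi>). if \<exists>v. (u, v) \<in> acc M a \<and> \<not> sat M v \<chi>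
     then SOME v. (u, v) \<in> acc M a \<and> \<not> sat M v \<chi> else SOME v. (u, v) \<in> acc M a)"
  define U where "U = (\<lambda>l. foldl h w l) ` lists (F \<times> Sub)"
  have finS: "finite Sub" by (simp add: Sub_def finite_subfms)
  have "F \<subseteq> (\<lambda>\<chi>. case \<chi> of Know a _ \<Rightarrow> a | _ \<Rightarrow> undefined) ` Sub"
    unfolding F_def by (force simp: image_iff)
  then have finF: "finite F" using finS finite_surj by blast
  have cU: "countable U" unfolding U_def
    by (intro countable_image countable_lists countable_finite) (use finS finF in simp)
  have wU: "w \<in> U" unfolding U_def by (rule image_eqI[where x = "[]"]) auto
  have hU: "h u (a, \<chi>) \<in> U" if u: "u \<in> U" and "a \<in> F" "\<chi> \<in> Sub" for u a \<chi>
  proof -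
    from u obtain l where l: "l \<in> lists (F \<times> Sub)" "u = foldl h w l" unfolding U_def by blast
    show ?thesis unfolding U_def
      by (rule image_eqI[where x = "l @ [(a, \<chi>)]"]) (use l that in auto)
  qed
  have hacc: "(u, h u (a, \<chi>)) \<in> acc M a" if "u \<in> worlds M" for u a \<chi>
  proof -
    have ex: "\<exists>v. (u, v) \<in> acc M a" using M that unfolding kd45_def by blast
    show ?thesis
    proof (cases "\<exists>v. (u, v) \<in> acc M a \<and> \<not> sat M v \<chi>")
      case True
      from someI_ex[OF True] show ?thesis using True unfolding h_def by simp
    next
      case False
      from someI_ex[OF ex] show ?thesis unfolding h_def using False by auto
    qed
  qed
  have hsat: "\<not> sat M (h u (a, \<chi>)) \<chi>" if "(u, v) \<in> acc M a" "\<not> sat M v \<chi>" for u v a \<chi>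
  proof -
    have ex: "\<exists>v. (u, v) \<in> acc M a \<and> \<not> sat M v \<chi>" using that by blast
    from someI_ex[OF ex] show ?thesis using ex unfolding h_def by simp
  qed
  have accW: "acc M a \<subseteq> worlds M \<times> worlds M" for a using M unfolding kd45_def by blast
  have "foldl h u l \<in> worlds M" if "u \<in> worlds M" for u l
    using that
  proof (induction l arbitrary: u)
    case (Cons x l)
    then show ?case using hacc[of u "fst x" "snd x"] accW by (cases x) auto
  qed simp
  then have UW: "U \<subseteq> worlds M" unfolding U_def using w by blast
  define f where "f = to_nat_on U"
  have inj: "inj_on f U" unfolding f_def using cU by (rule inj_on_to_nat_on)
  define N :: "('p, 'a, nat) kmodel" where "N = \<lparr>worlds = f ` U,
     acc = \<lambda>a. if a \<in> F then map_prod f f ` (acc M a \<inter> U \<times> U) else Id_on (f ` U),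
     val = \<lambda>p. f ` (val M p \<inter> U)\<rparr>"
  have accN: "(f u, f v) \<in> acc N a \<longleftrightarrow> (u, v) \<in> acc M a" if "u \<in> U" "v \<in> U" "a \<in> F" for u v a
  proof -
    have "(f u, f v) \<in> map_prod f f ` (acc M a \<inter> U \<times> U) \<longleftrightarrow> (u, v) \<in> acc M a"
    proof
      assume "(f u, f v) \<in> map_prod f f ` (acc M a \<inter> U \<times> U)"
      then obtain u' v' where "(u', v') \<in> acc M a" "u' \<in> U" "v' \<in> U" "f u = f u'" "f v = f v'"
        by auto
      then show "(u, v) \<in> acc M a" using that inj by (metis inj_onD)
    next
      assume "(u, v) \<in> acc M a"
      then show "(f u, f v) \<in> map_prod f f ` (acc M a \<inter> U \<times> U)"
        using that by (intro image_eqI[where x = "(u, v)"]) auto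
    qed
    then show ?thesis using that by (simp add: N_def)
  qed
  have accNU: "(x, y) \<in> acc N a \<Longrightarrow> x \<in> f ` U \<and> y \<in> f ` U" for x y a
    by (auto simp: N_def split: if_splits)
  have serN: "\<exists>y. (f u, y) \<in> acc N a" if u: "u \<in> U" for u a
  proof (cases "a \<in> F")
    case True
    have "\<phi> \<in> Sub" using subfms_self unfolding Sub_def by blast
    then have "h u (a, \<phi>) \<in> U" using hU u True by blast
    then show ?thesis using accN[OF u _ True] hacc UW u by blast
  next
    case False
    then show ?thesis using u by (auto simp: N_def)
  qed
  have tr: "trans (acc N a)" for a
  proof (cases "a \<in> F")
    case True
    have "trans (acc M a)" using M unfolding kd45_def by blast
    show ?thesis
    proof (rule transI)
      fix x y z assume xy: "(x, y) \<in> acc N a" and yz: "(y, z) \<in> acc N a"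
      obtain u v t where *: "u \<in> U" "v \<in> U" "t \<in> U" "x = f u" "y = f v" "z = f t"
        using accNU[OF xy] accNU[OF yz] by blast
      then show "(x, z) \<in> acc N a" using xy yz accN[OF _ _ True] \<open>trans (acc M a)\<close>
        by (metis transD)
    qed
  qed (auto simp: N_def trans_def)
  have eu: "euclidean (acc N a)" for a
  proof (cases "a \<in> F")
    case True
    have e: "euclidean (acc M a)" using M unfolding kd45_def by blast
    show ?thesis unfolding euclidean_def
    proof (intro allI impI)
      fix x y z assume xy: "(x, y) \<in> acc N a" and yz: "(x, z) \<in> acc N a"
      obtain u v t where *: "u \<in> U" "v \<in> U" "t \<in> U" "x = f u" "y = f v" "z = f t"
        using accNU[OF xy] accNU[OF yz] by blast
      then show "(y, z) \<in> acc N a" using xy yz accN[OF _ _ True] e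
        unfolding euclidean_def by metis
    qed
  qed (auto simp: N_def euclidean_def)
  have "acc N a \<subseteq> worlds N \<times> worlds N" for a using accNU by (auto simp: N_def)
  moreover have "\<forall>x\<in>worlds N. \<exists>y. (x, y) \<in> acc N a" for a using serN by (auto simp: N_def)
  ultimately have kN: "kd45 N" unfolding kd45_def using tr eu by blast
  have truth: "\<chi> \<in> Sub \<Longrightarrow> u \<in> U \<Longrightarrow> sat N (f u) \<chi> = sat M u \<chi>" for \<chi> u
  proof (induction \<chi> arbitrary: u)
    case (Atom p)
    then show ?case using inj by (auto simp: N_def inj_on_def)
  next
    case (Neg \<chi>)
    have "\<chi> \<in> Sub" using Neg.prems(1) subfms_trans subfms_self unfolding Sub_def by fastforce
    then show ?case using Neg by simp
  next
    case (Conj \<chi>1 \<chi>2)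
    have "\<chi>1 \<in> Sub" "\<chi>2 \<in> Sub"
      using Conj.prems(1) subfms_trans subfms_self unfolding Sub_def by fastforce+
    then show ?case using Conj by simp
  next
    case (Know a \<chi>)
    have s: "\<chi> \<in> Sub" using Know.prems(1) subfms_trans subfms_self unfolding Sub_def by fastforce
    have a: "a \<in> F" using Know.prems(1) unfolding F_def by blast
    have uW: "u \<in> worlds M" using Know.prems(2) UW by blast
    show ?case
    proof
      assume L: "sat N (f u) (Know a \<chi>)"
      show "sat M u (Know a \<chi>)"
      proof (rule ccontr)
        assume "\<not> sat M u (Know a \<chi>)"
        then obtain v where "(u, v) \<in> acc M a" "\<not> sat M v \<chi>" by auto
        then have ns: "\<not> sat M (h u (a, \<chi>)) \<chi>" by (rule hsat)
        have hu: "h u (a, \<chi>) \<in> U" using hU Know.prems(2) a s by blast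
        have "(f u, f (h u (a, \<chi>))) \<in> acc N a"
          using accN[OF Know.prems(2) hu a] hacc[OF uW] by blast
        then show False using L ns Know.IH[OF s hu] by auto
      qed
    next
      assume R: "sat M u (Know a \<chi>)"
      show "sat N (f u) (Know a \<chi>)"
      proof (simp, intro allI impI)
        fix y assume y: "(f u, y) \<in> acc N a"
        then obtain v where v: "v \<in> U" "y = f v" using accNU by blast
        then show "sat N y \<chi>" using R y accN[OF Know.prems(2) v(1) a] Know.IH[OF s v(1)] by auto
      qed
    qed
  qed
  have "sat N (f w) \<phi> = sat N (f w) \<psi>"
    using eq kN wU unfolding kd45_equiv_def by (auto simp: N_def)
  moreover have "\<phi> \<in> Sub" "\<psi> \<in> Sub" using subfms_self unfolding Sub_def by blast+
  ultimately show ?thesis using truth wU by blast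
qed

record ('p, 'a, 'e) amodel =
  events :: "'e set"
  arrow :: "'a \<Rightarrow> 'e rel"
  pre :: "'e \<Rightarrow> ('p, 'a) fm"

definition k45 :: "('p, 'a, 'e) amodel \<Rightarrow> bool" where
  "k45 N \<longleftrightarrow> (\<forall>a. trans (arrow N a) \<and> euclidean (arrow N a))"

definition FAct :: "('p, 'a) fm set \<Rightarrow> (('p, 'a, 'e) amodel \<times> 'e) set" where
  "FAct \<Phi> = {(N, t). t \<in> events N \<and> (\<forall>a. arrow N a \<subseteq> events N \<times> events N) \<and>
     finite (events N) \<and> k45 N \<and> pre N ` events N \<subseteq> \<Phi>}"

text \<open>\<open>rel_set Z A B\<close> says that every element of \<open>A\<close> is \<open>Z\<close>-related to some element of \<open>B\<close>
  and vice versa, that is, back and forth.\<close>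

definition bisimulation ::
  "('p, 'a, 'e) amodel \<Rightarrow> ('p, 'a, 'f) amodel \<Rightarrow> ('e \<Rightarrow> 'f \<Rightarrow> bool) \<Rightarrow> bool" where
  "bisimulation N N' Z \<longleftrightarrow> (\<forall>s s'. Z s s' \<longrightarrow> s \<in> events N \<and> s' \<in> events N' \<and>
     kd45_equiv (pre N s) (pre N' s') \<and>
     (\<forall>a. rel_set Z (arrow N a `` {s}) (arrow N' a `` {s'})))"

definition bisimilar ::
  "('p, 'a, 'e) amodel \<times> 'e \<Rightarrow> ('p, 'a, 'f) amodel \<times> 'f \<Rightarrow> bool" where
  "bisimilar = (\<lambda>(N, s) (N', s'). \<exists>Z. bisimulation N N' Z \<and> Z s s')"

text \<open>\<open>Learn B \<alpha> \<alpha>s\<close> is \<open>L\<^sub>B(\<alpha>, \<alpha>s)\<close>, with at least one argument, and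
  \<open>Restrict \<psi> B \<alpha>\<close> is \<open>\<psi>|\<^sub>B \<alpha>\<close>.\<close>

type_synonym var = nat

datatype ('p, 'a) trm =
    Var var
  | Test "('p, 'a) fm"
  | Learn "'a set" "('p, 'a) trm" "('p, 'a) trm list"
  | Meet "('p, 'a) trm" "('p, 'a) trm"
  | Restrict "('p, 'a) fm" "'a set" "('p, 'a) trm"
  | Mu var "('p, 'a) trm"

text \<open>The attributes, with \<open>None\<close> for undefined. The group of \<open>L\<^sub>B(\<alpha>, \<dots>)\<close> is always defined: an
  undefined group of \<open>\<alpha>\<close> contributes no agents.\<close>

fun group_of :: "('p, 'a) trm \<Rightarrow> 'a set option"
  and pre_of :: "('p, 'a) trm \<Rightarrow> ('p, 'a) fm option" where
  "group_of (Var x) = None"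
| "group_of (Test \<phi>) = Some {}"
| "group_of (Learn B \<alpha> \<alpha>s) = Some (B \<union> (case group_of \<alpha> of None \<Rightarrow> {} | Some G \<Rightarrow> G))"
| "group_of (Meet \<alpha> \<beta>) =
     (case (group_of \<alpha>, group_of \<beta>) of
        (Some G, Some H) \<Rightarrow>
          if G \<inter> H = {} \<and> pre_of \<alpha> \<noteq> None \<and> pre_of \<beta> = pre_of \<alpha> then Some (G \<union> H) else None
      | _ \<Rightarrow> None)"
| "group_of (Restrict \<psi> B \<alpha>) =
     (case group_of \<alpha> of Some G \<Rightarrow> if B \<subseteq> G then Some B else None | None \<Rightarrow> None)"
| "group_of (Mu x \<alpha>) = group_of \<alpha>"
| "pre_of (Var x) = None"
| "pre_of (Test \<phi>) = Some \<phi>"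
| "pre_of (Learn B \<alpha> \<alpha>s) = pre_of \<alpha>"
| "pre_of (Meet \<alpha> \<beta>) =
     (case (group_of \<alpha>, group_of \<beta>) of
        (Some G, Some H) \<Rightarrow>
          if G \<inter> H = {} \<and> pre_of \<beta> = pre_of \<alpha> then pre_of \<alpha> else None
      | _ \<Rightarrow> None)"
| "pre_of (Restrict \<psi> B \<alpha>) =
     (case group_of \<alpha> of Some G \<Rightarrow> if B \<subseteq> G then Some \<psi> else None | None \<Rightarrow> None)"
| "pre_of (Mu x \<alpha>) = pre_of \<alpha>"

text \<open>Term formation. The side condition of \<open>\<inter>\<close> is a condition on the formation of the term, since
  its semantics uses both groups. In \<open>\<psi>|\<^sub>B \<alpha>\<close> the condition on \<open>B\<close> is imposed whenever \<open>\<alpha>\<close> has a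
  group; if it has none, as for a variable, \<open>\<psi>|\<^sub>B \<alpha>\<close> is a term with undefined attributes.\<close>

fun is_term :: "('p, 'a) fm set \<Rightarrow> ('p, 'a) trm \<Rightarrow> bool" where
  "is_term \<Phi> (Var x) \<longleftrightarrow> True"
| "is_term \<Phi> (Test \<phi>) \<longleftrightarrow> \<phi> \<in> \<Phi>"
| "is_term \<Phi> (Learn B \<alpha> \<alpha>s) \<longleftrightarrow> is_term \<Phi> \<alpha> \<and> (\<forall>\<beta>\<in>set \<alpha>s. is_term \<Phi> \<beta>)"
| "is_term \<Phi> (Meet \<alpha> \<beta>) \<longleftrightarrow> is_term \<Phi> \<alpha> \<and> is_term \<Phi> \<beta> \<and> group_of (Meet \<alpha> \<beta>) \<noteq> None"
| "is_term \<Phi> (Restrict \<psi> B \<alpha>) \<longleftrightarrow>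
     \<psi> \<in> \<Phi> \<and> is_term \<Phi> \<alpha> \<and> (\<forall>G. group_of \<alpha> = Some G \<longrightarrow> B \<subseteq> G)"
| "is_term \<Phi> (Mu x \<alpha>) \<longleftrightarrow> is_term \<Phi> \<alpha> \<and> group_of \<alpha> \<noteq> None \<and> pre_of \<alpha> \<noteq> None"

fun fv :: "('p, 'a) trm \<Rightarrow> var set" where
  "fv (Var x) = {x}"
| "fv (Test \<phi>) = {}"
| "fv (Learn B \<alpha> \<alpha>s) = fv \<alpha> \<union> (\<Union>\<beta>\<in>set \<alpha>s. fv \<beta>)"
| "fv (Meet \<alpha> \<beta>) = fv \<alpha> \<union> fv \<beta>"
| "fv (Restrict \<psi> B \<alpha>) = fv \<alpha>"
| "fv (Mu x \<alpha>) = fv \<alpha> - {x}"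

definition RLP :: "('p, 'a) fm set \<Rightarrow> ('p, 'a) trm set" where
  "RLP \<Phi> = {\<alpha>. is_term \<Phi> \<alpha> \<and> fv \<alpha> = {}}"

text \<open>Events are named so that unions are disjoint: \<open>Root\<close> is the event added by a constructor,
  \<open>Copy l\<close> is \<open>(s\<^sub>l, 1)\<close>, \<open>In l e\<close> is the event \<open>e\<close> of the \<open>l\<close>-th argument, and \<open>Hole x\<close> is the
  placeholder \<open>s\<^sub>x\<close>. Arguments are numbered from 0.\<close>

datatype ev = Hole var | Root | Copy nat | In nat ev

text \<open>In an open model a precondition \<open>Inr x\<close> stands for the indeterminate \<open>pre(s\<^sub>x)\<close>. An element
  \<open>Inr x\<close> of the \<open>a\<close>-successors of \<open>e\<close> stands for the indeterminate set \<open>a[s\<^sub>x]\<close>, all of whose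
  elements are \<open>a\<close>-successors of \<open>e\<close>. No arrow leads to \<open>s\<^sub>x\<close> itself.\<close>

record ('p, 'a) omodel =
  oevents :: "ev set"
  oact :: ev
  osucc :: "'a \<Rightarrow> ev \<Rightarrow> (ev + var) set"
  opre :: "ev \<Rightarrow> ('p, 'a) fm + var"

text \<open>Bisimilarity of open models: an indeterminate matches only itself. Without indeterminates this
  is bisimilarity of action models (\<open>bisimulation_close\<close> below).\<close>

definition obisimulation ::
  "('p, 'a) omodel \<Rightarrow> ('p, 'a) omodel \<Rightarrow> (ev \<Rightarrow> ev \<Rightarrow> bool) \<Rightarrow> bool" where
  "obisimulation M M' Z \<longleftrightarrow> (\<forall>s s'. Z s s' \<longrightarrow> s \<in> oevents M \<and> s' \<in> oevents M' \<and>
     rel_sum kd45_equiv (=) (opre M s) (opre M' s') \<and>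
     (\<forall>a. rel_set (rel_sum Z (=)) (osucc M a s) (osucc M' a s')))"

definition obisimilar ::
  "('p, 'a) omodel \<Rightarrow> ('p, 'a) omodel \<Rightarrow> ev \<Rightarrow> ev \<Rightarrow> bool" where
  "obisimilar M M' s s' \<longleftrightarrow> (\<exists>Z. obisimulation M M' Z \<and> Z s s')"

definition agent_bisimilar :: "'a \<Rightarrow> ('p, 'a) omodel \<Rightarrow> ('p, 'a) omodel \<Rightarrow> bool" where
  "agent_bisimilar a M M' \<longleftrightarrow>
     rel_set (rel_sum (obisimilar M M') (=)) (osucc M a (oact M)) (osucc M' a (oact M'))"

definition var_model :: "var \<Rightarrow> ('p, 'a) omodel" where
  "var_model x = \<lparr>oevents = {Hole x}, oact = Hole x,
     osucc = (\<lambda>a e. {Inr x}), opre = (\<lambda>e. Inr x)\<rparr>"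

definition test_model :: "('p, 'a) fm \<Rightarrow> ('p, 'a) omodel" where
  "test_model \<phi> = \<lparr>oevents = {Root}, oact = Root,
     osucc = (\<lambda>a e. {}), opre = (\<lambda>e. Inl \<phi>)\<rparr>"

definition succ_in :: "nat \<Rightarrow> ('p, 'a) omodel \<Rightarrow> 'a \<Rightarrow> ev \<Rightarrow> (ev + var) set" where
  "succ_in l M a e = map_sum (In l) id ` osucc M a e"

text \<open>For \<open>a \<notin> B\<close> the successors of \<open>(s\<^sub>i, 1)\<close> are those of \<open>s\<^sub>i\<close>; there are none unless
  \<open>a \<in> gr((N\<^sub>i, s\<^sub>i))\<close>.\<close>

definition learn_model :: "'a set \<Rightarrow> ('p, 'a) omodel list \<Rightarrow> ('p, 'a) omodel" where
  "learn_model B Ms = \<lparr>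
     oevents = Copy ` {..<length Ms} \<union> (\<Union>l<length Ms. In l ` oevents (Ms ! l)),
     oact = Copy 0,
     osucc = (\<lambda>a e. case e of
         Copy i \<Rightarrow> if a \<in> B
           then {Inl (Copy j) | j. j < length Ms \<and> agent_bisimilar a (Ms ! i) (Ms ! j)}
           else succ_in i (Ms ! i) a (oact (Ms ! i))
       | In l e' \<Rightarrow> succ_in l (Ms ! l) a e'
       | _ \<Rightarrow> {}),
     opre = (\<lambda>e. case e of
         Copy i \<Rightarrow> opre (Ms ! i) (oact (Ms ! i))
       | In l e' \<Rightarrow> opre (Ms ! l) e'
       | _ \<Rightarrow> undefined)\<rparr>"

definition meet_model ::
  "'a set \<Rightarrow> 'a set \<Rightarrow> ('p, 'a) omodel \<Rightarrow> ('p, 'a) omodel \<Rightarrow> ('p, 'a) omodel" where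
  "meet_model G H M M' = \<lparr>
     oevents = insert Root (In 0 ` oevents M \<union> In 1 ` oevents M'),
     oact = Root,
     osucc = (\<lambda>a e. case e of
         Root \<Rightarrow> (if a \<in> G then succ_in 0 M a (oact M) else {}) \<union>
                 (if a \<in> H then succ_in 1 M' a (oact M') else {})
       | In l e' \<Rightarrow> succ_in l (if l = 0 then M else M') a e'
       | _ \<Rightarrow> {}),
     opre = (\<lambda>e. case e of
         Root \<Rightarrow> opre M (oact M)
       | In l e' \<Rightarrow> opre (if l = 0 then M else M') e'
       | _ \<Rightarrow> undefined)\<rparr>"

definition restrict_model ::
  "('p, 'a) fm \<Rightarrow> 'a set \<Rightarrow> ('p, 'a) omodel \<Rightarrow> ('p, 'a) omodel" where
  "restrict_model \<psi> B M = \<lparr>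
     oevents = insert Root (In 0 ` oevents M),
     oact = Root,
     osucc = (\<lambda>a e. case e of
         Root \<Rightarrow> if a \<in> B then succ_in 0 M a (oact M) else {}
       | In l e' \<Rightarrow> succ_in l M a e'
       | _ \<Rightarrow> {}),
     opre = (\<lambda>e. case e of
         Root \<Rightarrow> Inl \<psi>
       | In l e' \<Rightarrow> opre M e'
       | _ \<Rightarrow> undefined)\<rparr>"

fun is_hole :: "var \<Rightarrow> ev \<Rightarrow> bool" where
  "is_hole x (Hole y) \<longleftrightarrow> x = y"
| "is_hole x (In l e) \<longleftrightarrow> is_hole x e"
| "is_hole x _ \<longleftrightarrow> False"

text \<open>Replacing \<open>s\<^sub>x\<close> by the actual event: the (copies of the) placeholder disappear, and \<open>a[s\<^sub>x]\<close> and
  \<open>pre(s\<^sub>x)\<close> take the values they have at the actual event.\<close>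

definition mu_model :: "var \<Rightarrow> ('p, 'a) omodel \<Rightarrow> ('p, 'a) omodel" where
  "mu_model x M = \<lparr>
     oevents = {e \<in> oevents M. \<not> is_hole x e},
     oact = oact M,
     osucc = (\<lambda>a e. if Inr x \<in> osucc M a e
       then (osucc M a e - {Inr x}) \<union> osucc M a (oact M) else osucc M a e),
     opre = (\<lambda>e. if opre M e = Inr x then opre M (oact M) else opre M e)\<rparr>"

fun sem :: "('p, 'a) trm \<Rightarrow> ('p, 'a) omodel" where
  "sem (Var x) = var_model x"
| "sem (Test \<phi>) = test_model \<phi>"
| "sem (Learn B \<alpha> \<alpha>s) = learn_model B (sem \<alpha> # map sem \<alpha>s)"
| "sem (Meet \<alpha> \<beta>) = meet_model (the (group_of \<alpha>)) (the (group_of \<beta>)) (sem \<alpha>) (sem \<beta>)"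
| "sem (Restrict \<psi> B \<alpha>) = restrict_model \<psi> B (sem \<alpha>)"
| "sem (Mu x \<alpha>) = mu_model x (sem \<alpha>)"

text \<open>An open model without indeterminates is an action model. The open model of a closed term has
  none (\<open>determinate_sem\<close> below).\<close>

definition close :: "('p, 'a) omodel \<Rightarrow> ('p, 'a, ev) amodel" where
  "close M = \<lparr>events = oevents M,
     arrow = (\<lambda>a. {(e, t). e \<in> oevents M \<and> Inl t \<in> osucc M a e}),
     pre = (\<lambda>e. projl (opre M e))\<rparr>"

definition assoc_model :: "('p, 'a) trm \<Rightarrow> ('p, 'a, ev) amodel \<times> ev" where
  "assoc_model \<alpha> = (close (sem \<alpha>), oact (sem \<alpha>))"

definition determinate :: "('p, 'a) omodel \<Rightarrow> bool" where
  "determinate M \<longleftrightarrow>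
     (\<forall>e\<in>oevents M. (\<exists>\<phi>. opre M e = Inl \<phi>) \<and> (\<forall>a. osucc M a e \<subseteq> range Inl))"

lemma bisimulation_close:
  assumes "determinate M" "determinate M'"
  shows "bisimulation (close M) (close M') Z \<longleftrightarrow> obisimulation M M' Z"
proof -
  have 1: "rel_set Z (arrow (close M) a `` {s}) (arrow (close M') a `` {s'}) \<longleftrightarrow>
      rel_set (rel_sum Z (=)) (osucc M a s) (osucc M' a s')"
    if "s \<in> oevents M" "s' \<in> oevents M'" for a s s'
  proof -
    have s: "osucc M a s = Inl ` (arrow (close M) a `` {s})"
      and s': "osucc M' a s' = Inl ` (arrow (close M') a `` {s'})"
      using assms that unfolding determinate_def close_def by fastforce+
    show ?thesis unfolding s s' rel_set_def by simp
  qed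
  have 2: "kd45_equiv (pre (close M) s) (pre (close M') s') \<longleftrightarrow>
      rel_sum kd45_equiv (=) (opre M s) (opre M' s')"
    if "s \<in> oevents M" "s' \<in> oevents M'" for s s'
    using assms that unfolding determinate_def close_def by fastforce
  have 3: "events (close M) = oevents M" "events (close M') = oevents M'"
    by (simp_all add: close_def)
  show ?thesis unfolding bisimulation_def obisimulation_def 3 using 1 2 by blast
qed

lemma pre_of_group_of: "pre_of \<alpha> \<noteq> None \<Longrightarrow> group_of \<alpha> \<noteq> None"
  by (induction \<alpha>) (auto split: option.splits if_splits)

lemma opre_oact: "pre_of \<alpha> = Some \<phi> \<Longrightarrow> opre (sem \<alpha>) (oact (sem \<alpha>)) = Inl \<phi>"
  by (induction \<alpha> arbitrary: \<phi>)
    (auto simp: var_model_def test_model_def learn_model_def meet_model_def restrict_model_def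
      mu_model_def split: option.splits if_splits)

lemma oact_not_hole: "pre_of \<alpha> \<noteq> None \<Longrightarrow> \<not> is_hole x (oact (sem \<alpha>))"
  by (induction \<alpha>)
    (auto simp: var_model_def test_model_def learn_model_def meet_model_def restrict_model_def
      mu_model_def)

lemma oact_oevents: "is_term \<Phi> \<alpha> \<Longrightarrow> oact (sem \<alpha>) \<in> oevents (sem \<alpha>)"
  by (induction \<alpha>)
    (auto simp: var_model_def test_model_def learn_model_def meet_model_def restrict_model_def
      mu_model_def oact_not_hole)

lemma succ_in_range: "osucc M a e \<subseteq> range Inl \<Longrightarrow> succ_in l M a e \<subseteq> range Inl"
  unfolding succ_in_def by fastforce

lemma succ_in_empty: "osucc M a e = {} \<Longrightarrow> succ_in l M a e = {}"
  unfolding succ_in_def by simp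

lemma osucc_oact:
  "is_term \<Phi> \<alpha> \<Longrightarrow> group_of \<alpha> = Some G \<Longrightarrow>
    (a \<in> G \<longrightarrow> osucc (sem \<alpha>) a (oact (sem \<alpha>)) \<subseteq> range Inl) \<and>
    (pre_of \<alpha> \<noteq> None \<longrightarrow> a \<notin> G \<longrightarrow> osucc (sem \<alpha>) a (oact (sem \<alpha>)) = {})"
proof (induction \<alpha> arbitrary: G)
  case (Learn B \<alpha> \<alpha>s)
  show ?case
  proof (cases "group_of \<alpha>")
    case None
    then have "pre_of \<alpha> = None" using pre_of_group_of by blast
    then show ?thesis using None Learn.prems by (auto simp: learn_model_def)
  next
    case (Some H)
    show ?thesis
    proof (cases "a \<in> B")
      case True
      then show ?thesis using Some Learn.prems by (auto simp: learn_model_def)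
    next
      case False
      then show ?thesis using Some Learn.prems Learn.IH(1)[of H]
        by (auto simp: learn_model_def succ_in_empty dest: succ_in_range[THEN subsetD, rotated])
    qed
  qed
next
  case (Meet \<alpha> \<beta>)
  from Meet.prems(2) obtain H K where
    *: "group_of \<alpha> = Some H" "group_of \<beta> = Some K" "G = H \<union> K"
    by (auto split: option.splits if_splits)
  then show ?case using Meet.prems(1) Meet.IH(1)[of H] Meet.IH(2)[of K]
    by (cases "a \<in> H"; cases "a \<in> K") (simp_all add: meet_model_def succ_in_range)
next
  case (Restrict \<psi> B \<alpha>)
  from Restrict.prems(2) obtain H where *: "group_of \<alpha> = Some H" "B \<subseteq> H" "G = B"
    by (auto split: option.splits if_splits)
  then have "a \<in> B \<Longrightarrow> a \<in> H" by blast
  then show ?case using * Restrict.prems(1) Restrict.IH[of H]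
    by (cases "a \<in> B") (simp_all add: restrict_model_def succ_in_range)
next
  case (Mu x \<alpha>)
  have "osucc (sem \<alpha>) a (oact (sem \<alpha>)) \<subseteq> range Inl"
    using Mu.prems Mu.IH[of G] by (cases "a \<in> G") auto
  then have "Inr x \<notin> osucc (sem \<alpha>) a (oact (sem \<alpha>))" by auto
  then show ?case using Mu.prems Mu.IH[of G] by (simp add: mu_model_def)
qed (simp_all add: test_model_def)

lemma succ_in_subset:
  "osucc M a e \<subseteq> range Inl \<union> Inr ` V \<Longrightarrow> succ_in l M a e \<subseteq> range Inl \<union> Inr ` V"
  unfolding succ_in_def by fastforce

lemma indeterminates_fv:
  "is_term \<Phi> \<alpha> \<Longrightarrow> e \<in> oevents (sem \<alpha>) \<Longrightarrow>
    opre (sem \<alpha>) e \<in> range Inl \<union> Inr ` fv \<alpha> \<and>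
    osucc (sem \<alpha>) a e \<subseteq> range Inl \<union> Inr ` fv \<alpha>"
proof (induction \<alpha> arbitrary: e)
  case (Learn B \<alpha> \<alpha>s)
  define ts where "ts = \<alpha> # \<alpha>s"
  define V where "V = fv (Learn B \<alpha> \<alpha>s)"
  have arg: "opre (map sem ts ! l) e' \<in> range Inl \<union> Inr ` V \<and>
      osucc (map sem ts ! l) a e' \<subseteq> range Inl \<union> Inr ` V"
    if l: "l < length ts" and e': "e' \<in> oevents (map sem ts ! l)" for l e'
  proof -
    have m: "ts ! l \<in> set ts" using l by simp
    have "is_term \<Phi> (ts ! l)" using m Learn.prems(1) by (auto simp: ts_def)
    moreover have "e' \<in> oevents (sem (ts ! l))" using e' l by simp
    moreover have "ts ! l = \<alpha> \<or> ts ! l \<in> set \<alpha>s" using m by (auto simp: ts_def)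
    ultimately have "opre (sem (ts ! l)) e' \<in> range Inl \<union> Inr ` fv (ts ! l) \<and>
        osucc (sem (ts ! l)) a e' \<subseteq> range Inl \<union> Inr ` fv (ts ! l)"
      using Learn.IH by metis
    moreover have "fv (ts ! l) \<subseteq> V" using m by (auto simp: ts_def V_def)
    ultimately show ?thesis using l by (simp only: nth_map) blast
  qed
  have act: "oact (map sem ts ! l) \<in> oevents (map sem ts ! l)" if l: "l < length ts" for l
  proof -
    have "ts ! l \<in> set ts" using l by simp
    then have "is_term \<Phi> (ts ! l)" using Learn.prems(1) by (auto simp: ts_def)
    then show ?thesis using l oact_oevents by simp
  qed
  have s: "sem (Learn B \<alpha> \<alpha>s) = learn_model B (map sem ts)" by (simp add: ts_def)
  have e: "e \<in> oevents (learn_model B (map sem ts))" using Learn.prems(2) s by simp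
  consider i where "e = Copy i" "i < length ts"
    | l e' where "e = In l e'" "l < length ts" "e' \<in> oevents (map sem ts ! l)"
    using e by (auto simp: learn_model_def)
  then show ?case
  proof cases
    case 1
    show ?thesis unfolding s V_def[symmetric]
      using 1(1) arg[OF 1(2) act[OF 1(2)]]
        succ_in_subset[OF conjunct2[OF arg[OF 1(2) act[OF 1(2)]]], of i]
      by (cases "a \<in> B") (auto simp: learn_model_def simp del: nth_map)
  next
    case 2
    show ?thesis unfolding s V_def[symmetric]
      using 2(1) arg[OF 2(2,3)] succ_in_subset[OF conjunct2[OF arg[OF 2(2,3)]], of l]
      by (simp add: learn_model_def del: nth_map)
  qed
next
  case (Meet \<alpha> \<beta>)
  define V where "V = fv \<alpha> \<union> fv \<beta>"
  have t: "is_term \<Phi> \<alpha>" "is_term \<Phi> \<beta>" using Meet.prems(1) by auto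
  have V: "fv \<alpha> \<subseteq> V" "fv \<beta> \<subseteq> V" by (auto simp: V_def)
  have l: "opre (sem \<alpha>) e' \<in> range Inl \<union> Inr ` V \<and>
      osucc (sem \<alpha>) a e' \<subseteq> range Inl \<union> Inr ` V" if "e' \<in> oevents (sem \<alpha>)" for e'
    using Meet.IH(1)[OF t(1) that] V(1) by blast
  have r: "opre (sem \<beta>) e' \<in> range Inl \<union> Inr ` V \<and>
      osucc (sem \<beta>) a e' \<subseteq> range Inl \<union> Inr ` V" if "e' \<in> oevents (sem \<beta>)" for e'
    using Meet.IH(2)[OF t(2) that] V(2) by blast
  consider "e = Root" | e' where "e = In 0 e'" "e' \<in> oevents (sem \<alpha>)"
    | e' where "e = In 1 e'" "e' \<in> oevents (sem \<beta>)"
    using Meet.prems(2) by (auto simp: meet_model_def)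
  then show ?case
  proof cases
    case 1
    then show ?thesis
      using l[OF oact_oevents[OF t(1)]] r[OF oact_oevents[OF t(2)]]
        succ_in_subset[of "sem \<alpha>" a "oact (sem \<alpha>)" V 0]
        succ_in_subset[of "sem \<beta>" a "oact (sem \<beta>)" V 1]
      by (simp add: meet_model_def V_def[symmetric])
  next
    case 2
    then show ?thesis using l[of e'] by (simp add: meet_model_def succ_in_subset V_def[symmetric])
  next
    case 3
    then show ?thesis using r[of e'] by (simp add: meet_model_def succ_in_subset V_def[symmetric])
  qed
next
  case (Restrict \<psi> B \<alpha>)
  have t: "is_term \<Phi> \<alpha>" using Restrict.prems(1) by auto
  consider "e = Root" | e' where "e = In 0 e'" "e' \<in> oevents (sem \<alpha>)"
    using Restrict.prems(2) by (auto simp: restrict_model_def)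
  then show ?case
  proof cases
    case 1
    then show ?thesis
      using Restrict.IH[OF t oact_oevents[OF t]]
      by (simp add: restrict_model_def succ_in_subset)
  next
    case 2
    then show ?thesis using Restrict.IH[OF t]
      by (simp add: restrict_model_def succ_in_subset)
  qed
next
  case (Mu x \<alpha>)
  then have t: "is_term \<Phi> \<alpha>" and "pre_of \<alpha> \<noteq> None" by auto
  then obtain \<phi> G where p: "pre_of \<alpha> = Some \<phi>" and g: "group_of \<alpha> = Some G"
    using pre_of_group_of by fastforce
  have "osucc (sem \<alpha>) a (oact (sem \<alpha>)) \<subseteq> range Inl"
    using osucc_oact[OF t g, of a] p by (cases "a \<in> G") auto
  moreover have "opre (sem \<alpha>) e \<in> range Inl \<union> Inr ` fv \<alpha>"
    "osucc (sem \<alpha>) a e \<subseteq> range Inl \<union> Inr ` fv \<alpha>"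
    using Mu.IH[OF t, of e] Mu.prems(2) by (auto simp: mu_model_def)
  ultimately show ?case using opre_oact[OF p] by (auto simp: mu_model_def)
qed (auto simp: var_model_def test_model_def)

lemma determinate_sem:
  assumes "\<alpha> \<in> RLP \<Phi>"
  shows "determinate (sem \<alpha>)"
proof -
  have t: "is_term \<Phi> \<alpha>" and "fv \<alpha> = {}" using assms by (simp_all add: RLP_def)
  then have "opre (sem \<alpha>) e \<in> range Inl \<and> osucc (sem \<alpha>) a e \<subseteq> range Inl"
    if "e \<in> oevents (sem \<alpha>)" for e a
    using indeterminates_fv[OF t that, of a] by simp
  then show ?thesis unfolding determinate_def by blast
qed

end

theory Submission
  imports Defs
begin

text \<open>Every constructor preserves the following form of open model: the successors of an event for an
  agent are either one indeterminate set, or a set of events all of which have exactly that set as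
  their successors. For closed programs only the second case remains, and it amounts to K45.

  Conversely, the events of a finite K45 model satisfy a system of equations with one variable per
  event, in which each event is rebuilt from its successors, and nested \<open>\<mu>\<close> solves this system. All
  groups and preconditions stay defined because variables only occur under \<open>\<psi>|\<^sub>C\<close> inside \<open>L\<^sub>B\<close>; with
  \<open>C\<close> disjoint from \<open>B\<close>, the arguments of \<open>L\<^sub>B\<close> have no successors for the agents in \<open>B\<close>, so they
  are all bisimilar for these agents and \<open>L\<^sub>B\<close> makes them one cluster.\<close>

section \<open>Programs denote finite K45 models\<close>

text \<open>A relation is transitive and Euclidean exactly if every successor of an event has the
  same successors as that event. Banning placeholders from \<open>T\<close> keeps \<open>T\<close>
  intact when \<open>mu_model\<close> deletes the copies of a placeholder.\<close>

definition k45_at :: "('p, 'a) omodel \<Rightarrow> 'a \<Rightarrow> ev \<Rightarrow> bool" where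
  "k45_at M a e \<longleftrightarrow> (\<exists>y. osucc M a e = {Inr y}) \<or>
     (\<exists>T\<subseteq>oevents M. osucc M a e = Inl ` T \<and>
       (\<forall>t\<in>T. osucc M a t = Inl ` T \<and> (\<forall>y. \<not> is_hole y t)))"

definition open_k45 :: "('p, 'a) fm set \<Rightarrow> ('p, 'a) omodel \<Rightarrow> bool" where
  "open_k45 \<Phi> M \<longleftrightarrow> finite (oevents M) \<and> oact M \<in> oevents M \<and>
     (\<forall>e\<in>oevents M. opre M e \<in> Inl ` \<Phi> \<union> range Inr \<and> (\<forall>a. k45_at M a e))"

lemma kd45_equiv_refl: "kd45_equiv \<phi> \<phi>"
  by (simp add: kd45_equiv_def)

section \<open>Symmetry and transitivity of agent bisimilarity\<close>

lemma obisimulation_conversep: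
  fixes M M' :: "('p, 'a) omodel"
  assumes "obisimulation M M' Z"
  shows "obisimulation M' M Z\<inverse>\<inverse>"
proof -
  have "rel_sum kd45_equiv (=) q p" if "rel_sum kd45_equiv (=) p q"
    for p q :: "('p, 'a) fm + var"
    using that by (cases p; cases q) (auto simp: kd45_equiv_def)
  moreover have "rel_set (rel_sum Z\<inverse>\<inverse> (=)) T S" if "rel_set (rel_sum Z (=)) S T"
    for S T :: "(ev + var) set"
    using that sum.rel_conversep[of Z "(=) :: var \<Rightarrow> var \<Rightarrow> bool"] by (simp add: rel_set_conversep)
  ultimately show ?thesis using assms unfolding obisimulation_def by auto
qed

lemma obisimulation_relcompp:
  fixes M M' M'' :: "('p, 'a) omodel"
  assumes "obisimulation M M' Z" "obisimulation M' M'' Z'"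
  shows "obisimulation M M'' (Z OO Z')"
proof -
  have "rel_sum kd45_equiv (=) p r" if "rel_sum kd45_equiv (=) p q" "rel_sum kd45_equiv (=) q r"
    for p q r :: "('p, 'a) fm + var"
    using that by (cases p; cases q; cases r) (auto simp: kd45_equiv_def)
  moreover have "rel_set (rel_sum (Z OO Z') (=)) S U"
    if "rel_set (rel_sum Z (=)) S T" "rel_set (rel_sum Z' (=)) T U" for S T U :: "(ev + var) set"
    using that sum.rel_compp[of Z Z' "(=)" "(=) :: var \<Rightarrow> var \<Rightarrow> bool"]
    by (auto simp: eq_OO rel_set_OO[symmetric])
  ultimately show ?thesis using assms unfolding obisimulation_def relcompp_apply by meson
qed

lemma agent_bisimilar_sym:
  assumes "agent_bisimilar a M M'"
  shows "agent_bisimilar a M' M"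
proof -
  have "(obisimilar M M')\<inverse>\<inverse> \<le> obisimilar M' M"
    unfolding obisimilar_def using obisimulation_conversep by fastforce
  then have "rel_set (rel_sum (obisimilar M M') (=))\<inverse>\<inverse> \<le> rel_set (rel_sum (obisimilar M' M) (=))"
    by (intro rel_set_mono) (simp add: sum.rel_mono flip: sum.rel_conversep)
  then show ?thesis using assms unfolding agent_bisimilar_def rel_set_conversep by blast
qed

lemma agent_bisimilar_trans:
  assumes "agent_bisimilar a M M'" "agent_bisimilar a M' M''"
  shows "agent_bisimilar a M M''"
proof -
  have "obisimilar M M' OO obisimilar M' M'' \<le> obisimilar M M''"
    unfolding obisimilar_def using obisimulation_relcompp by fastforce
  then have "rel_sum (obisimilar M M' OO obisimilar M' M'') ((=) OO (=))
      \<le> rel_sum (obisimilar M M'') (=)"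
    by (intro sum.rel_mono) auto
  then have "rel_set (rel_sum (obisimilar M M') (=)) OO rel_set (rel_sum (obisimilar M' M'') (=))
      \<le> rel_set (rel_sum (obisimilar M M'') (=))"
    unfolding rel_set_OO sum.rel_compp[symmetric] by (rule rel_set_mono)
  then show ?thesis using assms unfolding agent_bisimilar_def by blast
qed

section \<open>Constructors preserve the open form of K45\<close>

lemma succ_in_Inl: "osucc M a e = Inl ` T \<Longrightarrow> succ_in l M a e = Inl ` In l ` T"
  by (auto simp: succ_in_def image_image)

lemma succ_in_Inr: "osucc M a e = {Inr y} \<Longrightarrow> succ_in l M a e = {Inr y}"
  by (simp add: succ_in_def)

lemma k45_atI:
  assumes "osucc M a e = Inl ` T" "T \<subseteq> oevents M"
    and "\<And>t. t \<in> T \<Longrightarrow> osucc M a t = Inl ` T \<and> (\<forall>y. \<not> is_hole y t)"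
  shows "k45_at M a e"
  unfolding k45_at_def using assms by (intro disjI2 exI[of _ T] conjI ballI) simp_all

lemma k45_atE:
  assumes "k45_at M a e"
  obtains y where "osucc M a e = {Inr y}"
    | T where "osucc M a e = Inl ` T" "T \<subseteq> oevents M"
      "\<And>t. t \<in> T \<Longrightarrow> osucc M a t = Inl ` T \<and> (\<forall>y. \<not> is_hole y t)"
  using assms unfolding k45_at_def by meson

lemma k45_at_empty: "osucc M a e = {} \<Longrightarrow> k45_at M a e"
  by (rule k45_atI[of _ _ _ "{}"]) simp_all

text \<open>Serves every event of a compound model that inherits its \<open>a\<close>-successors
  from an argument, be it an embedded event or a new one. Indeterminate sets pass unchanged;
  otherwise the renaming \<open>In l\<close> carries \<open>T\<close> to a set of the same kind,
  since embedded events keep their successors.\<close>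

lemma k45_at_succ_in:
  assumes M: "open_k45 \<Phi> M" "e \<in> oevents M"
    and sub: "In l ` oevents M \<subseteq> oevents L"
    and inner: "\<And>t. osucc L a (In l t) = succ_in l M a t"
    and succ: "osucc L a e' = succ_in l M a e"
  shows "k45_at L a e'"
proof -
  have "k45_at M a e" using M by (simp add: open_k45_def)
  then show ?thesis
  proof (cases rule: k45_atE)
    case (1 y)
    then show ?thesis using succ by (simp add: k45_at_def succ_in_Inr)
  next
    case (2 T)
    show ?thesis
    proof (rule k45_atI)
      show "osucc L a e' = Inl ` In l ` T" using succ succ_in_Inl[OF 2(1)] by simp
      show "In l ` T \<subseteq> oevents L" using 2(2) sub by blast
      show "osucc L a t = Inl ` In l ` T \<and> (\<forall>y. \<not> is_hole y t)" if "t \<in> In l ` T" for t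
        using that 2(3) inner by (auto simp: succ_in_Inl)
    qed
  qed
qed

lemma open_k45_learn_model:
  assumes "Ms \<noteq> []" "\<And>M. M \<in> set Ms \<Longrightarrow> open_k45 \<Phi> M"
  shows "open_k45 \<Phi> (learn_model B Ms)"
proof -
  let ?L = "learn_model B Ms"
  have arg: "open_k45 \<Phi> (Ms ! l)" if "l < length Ms" for l using assms(2) that by simp
  then have act: "oact (Ms ! l) \<in> oevents (Ms ! l)" if "l < length Ms" for l
    using that by (simp add: open_k45_def)
  have sub: "In l ` oevents (Ms ! l) \<subseteq> oevents ?L" if "l < length Ms" for l
    using that by (auto simp: learn_model_def)
  have inner: "osucc ?L a (In l t) = succ_in l (Ms ! l) a t" for a l t
    by (simp add: learn_model_def)
  have copy: "k45_at ?L a (Copy i)" if i: "i < length Ms" for a i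
  proof (cases "a \<in> B")
    case True
    define T where "T = (\<lambda>i. Copy ` {j. j < length Ms \<and> agent_bisimilar a (Ms ! i) (Ms ! j)})"
    have s: "osucc ?L a (Copy k) = Inl ` T k" for k
      using True by (auto simp: learn_model_def T_def)
    \<comment> \<open>Symmetry and transitivity make bisimilar arguments share their class of
      copies, so each member of \<open>T i\<close> has \<open>T i\<close> as its successors.\<close>
    have "T j = T i" if "agent_bisimilar a (Ms ! i) (Ms ! j)" for j
      unfolding T_def by (metis that agent_bisimilar_sym agent_bisimilar_trans)
    then have "osucc ?L a t = Inl ` T i \<and> (\<forall>y. \<not> is_hole y t)" if "t \<in> T i" for t
      using that s by (auto simp: T_def)
    moreover have "T i \<subseteq> oevents ?L" by (auto simp: T_def learn_model_def)
    ultimately show ?thesis using s[of i] k45_atI by metis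
  next
    case False
    then have "osucc ?L a (Copy i) = succ_in i (Ms ! i) a (oact (Ms ! i))"
      by (simp add: learn_model_def)
    then show ?thesis by (rule k45_at_succ_in[OF arg[OF i] act[OF i] sub[OF i] inner])
  qed
  have "k45_at ?L a (In l e)" if "l < length Ms" "e \<in> oevents (Ms ! l)" for a l e
    using inner by (rule k45_at_succ_in[OF arg[OF that(1)] that(2) sub[OF that(1)] inner])
  with copy have "\<forall>e\<in>oevents ?L. \<forall>a. k45_at ?L a e" by (auto simp: learn_model_def)
  moreover have "\<forall>e\<in>oevents ?L. opre ?L e \<in> Inl ` \<Phi> \<union> range Inr"
    using arg act by (fastforce simp: learn_model_def open_k45_def)
  moreover have "finite (oevents ?L)" using arg by (auto simp: learn_model_def open_k45_def)
  moreover have "oact ?L \<in> oevents ?L" using assms(1) by (simp add: learn_model_def)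
  ultimately show ?thesis unfolding open_k45_def by blast
qed

lemma open_k45_meet_model:
  assumes M: "open_k45 \<Phi> M" and M': "open_k45 \<Phi> M'" and "G \<inter> H = {}"
  shows "open_k45 \<Phi> (meet_model G H M M')"
proof -
  let ?L = "meet_model G H M M'"
  have act: "oact M \<in> oevents M" "oact M' \<in> oevents M'" using M M' by (simp_all add: open_k45_def)
  have sub: "In 0 ` oevents M \<subseteq> oevents ?L" "In 1 ` oevents M' \<subseteq> oevents ?L"
    by (auto simp: meet_model_def)
  have inner: "osucc ?L a (In 0 t) = succ_in 0 M a t" "osucc ?L a (In 1 t) = succ_in 1 M' a t" for a t
    by (simp_all add: meet_model_def)
  \<comment> \<open>Disjoint groups let each agent see at most one argument from the root; a union
    of two clusters need not be a cluster.\<close>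
  have "osucc ?L a Root = succ_in 0 M a (oact M) \<or> osucc ?L a Root = succ_in 1 M' a (oact M') \<or>
      osucc ?L a Root = {}" for a
    using assms(3) by (auto simp: meet_model_def)
  then have root: "k45_at ?L a Root" for a
    using k45_at_succ_in[OF M act(1) sub(1) inner(1)] k45_at_succ_in[OF M' act(2) sub(2) inner(2)]
      k45_at_empty by metis
  have "k45_at ?L a (In 0 e)" if "e \<in> oevents M" for a e
    using inner(1) by (rule k45_at_succ_in[OF M that sub(1) inner(1)])
  moreover have "k45_at ?L a (In 1 e)" if "e \<in> oevents M'" for a e
    using inner(2) by (rule k45_at_succ_in[OF M' that sub(2) inner(2)])
  ultimately have "\<forall>e\<in>oevents ?L. \<forall>a. k45_at ?L a e" using root by (auto simp: meet_model_def)
  moreover have "\<forall>e\<in>oevents ?L. opre ?L e \<in> Inl ` \<Phi> \<union> range Inr"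
    using M M' by (auto simp: meet_model_def open_k45_def)
  moreover have "finite (oevents ?L)" "oact ?L \<in> oevents ?L"
    using M M' by (simp_all add: meet_model_def open_k45_def)
  ultimately show ?thesis unfolding open_k45_def by blast
qed

lemma open_k45_restrict_model:
  assumes M: "open_k45 \<Phi> M" and "\<psi> \<in> \<Phi>"
  shows "open_k45 \<Phi> (restrict_model \<psi> B M)"
proof -
  let ?L = "restrict_model \<psi> B M"
  have act: "oact M \<in> oevents M" using M by (simp add: open_k45_def)
  have sub: "In 0 ` oevents M \<subseteq> oevents ?L" by (auto simp: restrict_model_def)
  have inner: "osucc ?L a (In 0 t) = succ_in 0 M a t" for a t by (simp add: restrict_model_def)
  have "osucc ?L a Root = (if a \<in> B then succ_in 0 M a (oact M) else {})" for a
    by (simp add: restrict_model_def)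
  then have root: "k45_at ?L a Root" for a
    using k45_at_succ_in[OF M act sub inner] k45_at_empty by metis
  have "k45_at ?L a (In 0 e)" if "e \<in> oevents M" for a e
    using inner by (rule k45_at_succ_in[OF M that sub inner])
  then have "\<forall>e\<in>oevents ?L. \<forall>a. k45_at ?L a e" using root by (auto simp: restrict_model_def)
  moreover have "\<forall>e\<in>oevents ?L. opre ?L e \<in> Inl ` \<Phi> \<union> range Inr"
    using assms by (auto simp: restrict_model_def open_k45_def)
  moreover have "finite (oevents ?L)" "oact ?L \<in> oevents ?L"
    using M by (simp_all add: restrict_model_def open_k45_def)
  ultimately show ?thesis unfolding open_k45_def by blast
qed

text \<open>What replaces \<open>{Inr x}\<close> is the successor set of the actual event. By
  \<open>succ\<close> it consists of events, hence is a set \<open>T\<close> as in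
  \<open>k45_at\<close>, and no member is deleted because none is a placeholder.\<close>

lemma open_k45_mu_model:
  assumes M: "open_k45 \<Phi> M" and nh: "\<not> is_hole x (oact M)"
    and pre: "opre M (oact M) \<in> range Inl" and succ: "\<And>a. osucc M a (oact M) \<subseteq> range Inl"
  shows "open_k45 \<Phi> (mu_model x M)"
proof -
  let ?L = "mu_model x M"
  have act: "oact M \<in> oevents M" using M by (simp add: open_k45_def)
  \<comment> \<open>From \<open>e'\<close> the event \<open>e\<close> gets its successors:
    \<open>e'\<close> is the actual event if \<open>{Inr x}\<close> is replaced, and
    \<open>e\<close> itself otherwise.\<close>
  have det: "k45_at ?L a e"
    if T: "osucc M a e' = Inl ` T" and e: "osucc ?L a e = osucc M a e'" "e' \<in> oevents M" for T a e e'
  proof -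
    have "k45_at M a e'" using M e(2) by (simp add: open_k45_def)
    then have *: "T \<subseteq> oevents M \<and> (\<forall>t\<in>T. osucc M a t = Inl ` T \<and> (\<forall>y. \<not> is_hole y t))"
      using T by (cases rule: k45_atE) (auto simp: inj_image_eq_iff)
    have "osucc ?L a e = Inl ` T" using T e(1) by simp
    then show ?thesis by (rule k45_atI) (use * in \<open>auto simp: mu_model_def\<close>)
  qed
  have "k45_at ?L a e" if "e \<in> oevents ?L" for e a
  proof -
    have e: "e \<in> oevents M" using that by (simp add: mu_model_def)
    then have "k45_at M a e" using M by (simp add: open_k45_def)
    then consider "osucc M a e = {Inr x}" | y where "osucc M a e = {Inr y}" "y \<noteq> x"
      | T where "osucc M a e = Inl ` T"
      by (metis k45_atE)
    then show ?thesis
    proof cases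
      case 1
      obtain T where T: "osucc M a (oact M) = Inl ` T" using succ[of a] by (auto simp: subset_image_iff)
      have "osucc ?L a e = osucc M a (oact M)" using 1 by (simp add: mu_model_def)
      then show ?thesis using act by (rule det[OF T])
    next
      case 2
      then show ?thesis by (simp add: mu_model_def k45_at_def)
    next
      case 3
      then have "osucc ?L a e = osucc M a e" by (auto simp: mu_model_def)
      then show ?thesis using e by (rule det[OF 3])
    qed
  qed
  moreover have "\<forall>e\<in>oevents ?L. opre ?L e \<in> Inl ` \<Phi> \<union> range Inr"
    using M act by (auto simp: mu_model_def open_k45_def)
  moreover have "finite (oevents ?L)" "oact ?L \<in> oevents ?L"
    using M nh by (simp_all add: mu_model_def open_k45_def)
  ultimately show ?thesis unfolding open_k45_def by blast
qed

text \<open>Agents in the group have determinate successors at the actual event and all others have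
  none. This is the determinacy required of the body of \<open>Mu\<close>.\<close>

lemma osucc_oact_range_Inl:
  assumes "is_term \<Phi> \<alpha>" "pre_of \<alpha> \<noteq> None"
  shows "osucc (sem \<alpha>) a (oact (sem \<alpha>)) \<subseteq> range Inl"
proof -
  obtain G where "group_of \<alpha> = Some G" using assms(2) pre_of_group_of by blast
  then show ?thesis using osucc_oact[OF assms(1), of G a] assms(2) by (cases "a \<in> G") auto
qed

lemma open_k45_sem: "is_term \<Phi> \<alpha> \<Longrightarrow> open_k45 \<Phi> (sem \<alpha>)"
proof (induction \<alpha>)
  case (Learn B \<alpha> \<alpha>s)
  then show ?case by (auto intro!: open_k45_learn_model)
next
  case (Meet \<alpha> \<beta>)
  then show ?case by (auto intro!: open_k45_meet_model split: option.splits if_splits)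
next
  case (Mu x \<alpha>)
  then show ?case
    using osucc_oact_range_Inl[of \<Phi> \<alpha>] opre_oact[of \<alpha>] oact_not_hole[of \<alpha> x]
    by (auto intro!: open_k45_mu_model)
next
  case (Restrict \<psi> B \<alpha>)
  then show ?case by (simp add: open_k45_restrict_model)
qed (auto simp: open_k45_def k45_at_def var_model_def test_model_def)

lemma assoc_model_in_FAct:
  assumes "\<alpha> \<in> RLP \<Phi>"
  shows "assoc_model \<alpha> \<in> FAct \<Phi>"
proof -
  let ?M = "sem \<alpha>" and ?N = "close (sem \<alpha>)"
  have M: "open_k45 \<Phi> ?M" using assms by (simp add: RLP_def open_k45_sem)
  have d: "determinate ?M" using assms by (rule determinate_sem)
  have cl: "\<exists>T\<subseteq>oevents ?M. osucc ?M a e = Inl ` T \<and> (\<forall>t\<in>T. osucc ?M a t = Inl ` T)"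
    if "e \<in> oevents ?M" for a e
  proof -
    have "osucc ?M a e \<subseteq> range Inl" using d that by (simp add: determinate_def)
    then have "\<nexists>y. osucc ?M a e = {Inr y}" by auto
    moreover have "k45_at ?M a e" using M that by (simp add: open_k45_def)
    ultimately show ?thesis by (metis k45_atE)
  qed
  have same: "osucc ?M a t = osucc ?M a e \<and> t \<in> oevents ?M" if "(e, t) \<in> arrow ?N a" for a e t
    using that cl[of e a] by (auto simp: close_def)
  have arr: "(e, t) \<in> arrow ?N a \<longleftrightarrow> e \<in> oevents ?M \<and> Inl t \<in> osucc ?M a e" for e t a
    by (simp add: close_def)
  have "k45 ?N" unfolding k45_def trans_def euclidean_def using same arr by metis
  moreover have "arrow ?N a \<subseteq> events ?N \<times> events ?N" for a
  proof (rule subrelI)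
    fix e t
    assume "(e, t) \<in> arrow ?N a"
    then have "e \<in> oevents ?M" "t \<in> oevents ?M" using same arr by blast+
    then show "(e, t) \<in> events ?N \<times> events ?N" by (simp add: close_def)
  qed
  moreover have "pre ?N ` events ?N \<subseteq> \<Phi>"
    using M d by (fastforce simp: close_def open_k45_def determinate_def)
  moreover have "finite (events ?N)" "oact ?M \<in> events ?N"
    using M by (simp_all add: close_def open_k45_def)
  ultimately show ?thesis by (simp add: FAct_def assoc_model_def)
qed

section \<open>Programs for finite K45 models\<close>

locale named_events =
  fixes N :: "('p, 'a, 'e) amodel" and name :: "'e \<Rightarrow> var"
begin

definition succs :: "'a \<Rightarrow> 'e \<Rightarrow> 'e set" where
  "succs a u = arrow N a `` {u}"

text \<open>The set \<open>S\<close> contains the events whose names may occur as indeterminates; such an indeterminate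
  has to stand for the right set of successors.\<close>

definition matches :: "'e set \<Rightarrow> (ev \<Rightarrow> 'e \<Rightarrow> bool) \<Rightarrow> (ev + var) set \<Rightarrow> 'a \<Rightarrow> 'e \<Rightarrow> bool" where
  "matches S Z X a u \<longleftrightarrow> (\<exists>v\<in>S. X = {Inr (name v)} \<and> succs a v = succs a u) \<or>
     (\<exists>A. X = Inl ` A \<and> rel_set Z A (succs a u))"

text \<open>A bisimulation between \<open>M\<close> and \<open>N\<close> in which successor sets,
  but not preconditions, may be indeterminate. Related events are not placeholders, so
  \<open>mu_model\<close> keeps them.\<close>

definition represents :: "'e set \<Rightarrow> ('p, 'a) omodel \<Rightarrow> (ev \<Rightarrow> 'e \<Rightarrow> bool) \<Rightarrow> bool" where
  "represents S M Z \<longleftrightarrow> (\<forall>e u. Z e u \<longrightarrow> e \<in> oevents M \<and> (\<forall>y. \<not> is_hole y e) \<and>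
     u \<in> events N \<and> opre M e = Inl (pre N u) \<and> (\<forall>a. matches S Z (osucc M a e) a u))"

text \<open>The actual event of \<open>M\<close> itself need not be matched with \<open>u\<close>, since its successors may be
  right for the agents in \<open>C\<close> only.\<close>

definition successors_match :: "'e set \<Rightarrow> 'a set \<Rightarrow> ('p, 'a) omodel \<Rightarrow> 'e \<Rightarrow> bool" where
  "successors_match S C M u \<longleftrightarrow>
     (\<exists>Z. represents S M Z \<and> (\<forall>a\<in>C. matches S Z (osucc M a (oact M)) a u))"

text \<open>Silence outside \<open>C\<close> is what makes the arguments of
  \<open>learn_model\<close> bisimilar for the agents of a cluster, and it is correct for agents
  without successors at \<open>u\<close>.\<close>

definition part_of :: "'e set \<Rightarrow> 'a set \<Rightarrow> ('p, 'a) omodel \<Rightarrow> 'e \<Rightarrow> bool" where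
  "part_of S C M u \<longleftrightarrow> successors_match S C M u \<and> (\<forall>a. a \<notin> C \<longrightarrow> osucc M a (oact M) = {}) \<and>
     opre M (oact M) = Inl (pre N u)"

section \<open>Matching under the constructors\<close>

lemma matches_mono: "matches S Z X a u \<Longrightarrow> Z \<le> Z' \<Longrightarrow> matches S Z' X a u"
  unfolding matches_def using rel_set_mono[of Z Z'] by blast

lemma matches_empty: "succs a u = {} \<Longrightarrow> matches S Z {} a u"
  unfolding matches_def by (auto simp: rel_set_def)

lemma matches_In:
  assumes "matches S Z (osucc M a e) a u" "\<And>e u. Z e u \<Longrightarrow> Z' (In l e) u"
  shows "matches S Z' (succ_in l M a e) a u"
proof -
  from assms(1) consider v where "v \<in> S" "osucc M a e = {Inr (name v)}" "succs a v = succs a u"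
    | A where "osucc M a e = Inl ` A" "rel_set Z A (succs a u)"
    unfolding matches_def by blast
  then show ?thesis
  proof cases
    case 1
    then show ?thesis unfolding matches_def by (auto simp: succ_in_Inr)
  next
    case 2
    have "rel_set Z' (In l ` A) (succs a u)" using 2(2) assms(2) unfolding rel_set_def by blast
    then show ?thesis unfolding matches_def using succ_in_Inl[OF 2(1)] by blast
  qed
qed

text \<open>The empty relation suffices: the placeholder has one indeterminate successor set, which
  \<open>matches\<close> accepts because \<open>u\<close> is in \<open>S\<close>.\<close>

lemma successors_match_var_model: "u \<in> S \<Longrightarrow> successors_match S C (var_model (name u)) u"
  unfolding successors_match_def represents_def
  by (rule exI[of _ "\<lambda>_ _. False"]) (auto simp: matches_def var_model_def)

lemma part_of_test_model: "part_of S {} (test_model (pre N u)) u"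
  unfolding part_of_def successors_match_def represents_def
  by (auto simp: test_model_def)

text \<open>The new root sets the precondition, which may be indeterminate at the actual event of
  \<open>M\<close>, and drops the agents outside \<open>B\<close>.\<close>

lemma part_of_restrict_model:
  assumes "successors_match S C M u" "B \<subseteq> C"
  shows "part_of S B (restrict_model (pre N u) B M) u"
proof -
  let ?L = "restrict_model (pre N u) B M"
  obtain Z where Z: "represents S M Z" "\<forall>a\<in>C. matches S Z (osucc M a (oact M)) a u"
    using assms(1) unfolding successors_match_def by blast
  define Z' where "Z' = (\<lambda>e u. \<exists>e'. e = In 0 e' \<and> Z e' u)"
  have "represents S ?L Z'"
    using Z(1) unfolding represents_def
    by (auto simp: restrict_model_def Z'_def intro!: matches_In[where Z = Z])
  moreover have "\<forall>a\<in>B. matches S Z' (osucc ?L a (oact ?L)) a u"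
    using Z(2) assms(2) by (auto simp: restrict_model_def Z'_def intro!: matches_In[where Z = Z])
  ultimately show ?thesis
    unfolding part_of_def successors_match_def by (auto simp: restrict_model_def)
qed

lemma part_of_meet_model:
  assumes "part_of S C M u" "part_of S D M' u" "C \<inter> D = {}"
  shows "part_of S (C \<union> D) (meet_model C D M M') u"
proof -
  let ?L = "meet_model C D M M'"
  obtain Z1 where Z1: "represents S M Z1" "\<forall>a\<in>C. matches S Z1 (osucc M a (oact M)) a u"
    using assms(1) unfolding successors_match_def part_of_def by blast
  obtain Z2 where Z2: "represents S M' Z2" "\<forall>a\<in>D. matches S Z2 (osucc M' a (oact M')) a u"
    using assms(2) unfolding successors_match_def part_of_def by blast
  define Z where "Z = (\<lambda>e u. (\<exists>e'. e = In 0 e' \<and> Z1 e' u) \<or> (\<exists>e'. e = In 1 e' \<and> Z2 e' u))"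
  have In: "Z1 e u \<Longrightarrow> Z (In 0 e) u" "Z2 e u \<Longrightarrow> Z (In 1 e) u" for e u by (auto simp: Z_def)
  note m = matches_In[where Z = Z1 and Z' = Z and l = 0, OF _ In(1)]
    matches_In[where Z = Z2 and Z' = Z and l = 1, OF _ In(2)]
  have L: "osucc ?L a (In 0 e) = succ_in 0 M a e" "osucc ?L a (In 1 e) = succ_in 1 M' a e"
    "opre ?L (In 0 e) = opre M e" "opre ?L (In 1 e) = opre M' e"
    "e \<in> oevents M \<Longrightarrow> In 0 e \<in> oevents ?L" "e \<in> oevents M' \<Longrightarrow> In 1 e \<in> oevents ?L" for a e
    by (simp_all add: meet_model_def)
  have "represents S ?L Z"
    unfolding represents_def
  proof (intro allI impI)
    fix e v
    assume "Z e v"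
    then consider e' where "e = In 0 e'" "Z1 e' v" | e' where "e = In 1 e'" "Z2 e' v"
      unfolding Z_def by blast
    then show "e \<in> oevents ?L \<and> (\<forall>y. \<not> is_hole y e) \<and> v \<in> events N \<and>
        opre ?L e = Inl (pre N v) \<and> (\<forall>a. matches S Z (osucc ?L a e) a v)"
    proof cases
      case (1 e')
      then show ?thesis using Z1(1) unfolding represents_def
        by (auto simp: L(1,3,5) simp del: One_nat_def intro: m(1))
    next
      case (2 e')
      then show ?thesis using Z2(1) unfolding represents_def
        by (auto simp: L(2,4,6) simp del: One_nat_def intro: m(2))
    qed
  qed
  moreover have "\<forall>a\<in>C \<union> D. matches S Z (osucc ?L a (oact ?L)) a u"
    using Z1(2) Z2(2) assms(3)
    by (auto simp: meet_model_def disjoint_iff simp del: One_nat_def intro: m)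
  moreover have "opre ?L (oact ?L) = Inl (pre N u)"
    using assms(1) by (simp add: meet_model_def part_of_def)
  moreover have "\<forall>a. a \<notin> C \<union> D \<longrightarrow> osucc ?L a (oact ?L) = {}" by (simp add: meet_model_def)
  ultimately show ?thesis unfolding part_of_def successors_match_def by blast
qed

text \<open>The event \<open>t\<close> may lie outside \<open>us\<close>. For agents in
  \<open>B\<close> it has the same successors as the members of \<open>us\<close>, so the actual
  event \<open>Copy 0\<close>, though matched with \<open>us ! 0\<close>, has the right successors
  for \<open>t\<close> as well.\<close>

lemma successors_match_learn_model:
  assumes len: "length us = length Ms" and us: "set us \<subseteq> events N" "us \<noteq> []"
    and cluster: "\<And>a u. a \<in> B \<Longrightarrow> u \<in> insert t (set us) \<Longrightarrow> succs a u = set us"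
    and args: "\<And>i. i < length us \<Longrightarrow> part_of S ({a. succs a (us ! i) \<noteq> {}} - B) (Ms ! i) (us ! i)"
  shows "successors_match S B (learn_model B Ms) t"
proof -
  let ?L = "learn_model B Ms"
  have "\<exists>Z. represents S (Ms ! i) Z \<and> (\<forall>a\<in>{a. succs a (us ! i) \<noteq> {}} - B.
      matches S Z (osucc (Ms ! i) a (oact (Ms ! i))) a (us ! i))" if "i < length us" for i
    using args[OF that] unfolding part_of_def successors_match_def by blast
  then obtain Z where Z: "\<And>i. i < length us \<Longrightarrow> represents S (Ms ! i) (Z i)"
    "\<And>i a. i < length us \<Longrightarrow> succs a (us ! i) \<noteq> {} \<Longrightarrow> a \<notin> B \<Longrightarrow>
      matches S (Z i) (osucc (Ms ! i) a (oact (Ms ! i))) a (us ! i)"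
    by (metis (mono_tags, lifting) DiffI mem_Collect_eq)
  define Z' where "Z' = (\<lambda>e u. (\<exists>i<length us. e = Copy i \<and> u = us ! i) \<or>
     (\<exists>i<length us. \<exists>e'. e = In i e' \<and> Z i e' u))"
  have In: "matches S Z' (succ_in i (Ms ! i) a e) a u"
    if "i < length us" "matches S (Z i) (osucc (Ms ! i) a e) a u" for i a e u
    using that by (auto simp: Z'_def intro: matches_In)
  have noB: "osucc (Ms ! i) a (oact (Ms ! i)) = {}"
    if "i < length us" "a \<in> B \<or> succs a (us ! i) = {}" for i a
    using args[OF that(1)] that(2) by (auto simp: part_of_def)
  \<comment> \<open>By \<open>noB\<close> the arguments have no \<open>a\<close>-successors, so any
    two are \<open>a\<close>-bisimilar and all copies form one cluster.\<close>
  have "osucc ?L a (Copy i) = Inl ` Copy ` {..<length us}" if "a \<in> B" "i < length us" for a i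
    using that noB len by (auto simp: learn_model_def agent_bisimilar_def rel_set_def)
  moreover have "rel_set Z' (Copy ` {..<length us}) (set us)"
    by (auto simp: rel_set_def Z'_def in_set_conv_nth)
  ultimately have copy: "matches S Z' (osucc ?L a (Copy i)) a u"
    if "a \<in> B" "i < length us" "u \<in> insert t (set us)" for a i u
    using that cluster unfolding matches_def by metis
  have "matches S Z' (osucc ?L a (Copy i)) a (us ! i)" if i: "i < length us" for a i
  proof (cases "a \<in> B")
    case True
    then show ?thesis using copy i by simp
  next
    case False
    then have *: "osucc ?L a (Copy i) = succ_in i (Ms ! i) a (oact (Ms ! i))"
      by (simp add: learn_model_def)
    show ?thesis
    proof (cases "succs a (us ! i) = {}")
      case True
      then show ?thesis using noB[OF i] * by (simp add: succ_in_empty matches_empty)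
    next
      case nonempty: False
      then show ?thesis using * In[OF i] Z(2)[OF i nonempty False] by simp
    qed
  qed
  moreover have "opre ?L (Copy i) = Inl (pre N (us ! i))" if "i < length us" for i
    using args[OF that] by (simp add: learn_model_def part_of_def)
  moreover have "Copy i \<in> oevents ?L" "us ! i \<in> events N" if "i < length us" for i
    using that len us(1) by (auto simp: learn_model_def)
  moreover have "In i e \<in> oevents ?L \<and> (\<forall>y. \<not> is_hole y (In i e)) \<and> u \<in> events N \<and>
      opre ?L (In i e) = Inl (pre N u) \<and> (\<forall>a. matches S Z' (osucc ?L a (In i e)) a u)"
    if "i < length us" "Z i e u" for i e u
  proof -
    have "e \<in> oevents (Ms ! i) \<Longrightarrow> In i e \<in> oevents ?L"
      using that(1) len by (auto simp: learn_model_def)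
    moreover have "osucc ?L a (In i e) = succ_in i (Ms ! i) a e" "opre ?L (In i e) = opre (Ms ! i) e" for a
      by (simp_all add: learn_model_def)
    ultimately show ?thesis
      using Z(1)[OF that(1)] that(2) In[OF that(1)] unfolding represents_def by simp
  qed
  ultimately have "represents S ?L Z'"
    unfolding represents_def by (auto simp: Z'_def)
  moreover have "oact ?L = Copy 0" by (simp add: learn_model_def)
  moreover have "0 < length us" using us(2) by simp
  ultimately show ?thesis unfolding successors_match_def using copy by auto
qed

text \<open>Where the indeterminate of \<open>t\<close> matched an event \<open>u\<close>, the
  events \<open>t\<close> and \<open>u\<close> have equal successors. The successors of the actual
  event match those of \<open>t\<close>, so they may replace it, and \<open>inj\<close> leaves the
  other indeterminates alone.\<close>

lemma part_of_mu_model: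
  assumes M: "part_of (insert t S) {a. succs a t \<noteq> {}} M t"
    and det: "\<And>a. osucc M a (oact M) \<subseteq> range Inl"
    and inj: "\<And>v. v \<in> S \<Longrightarrow> name v \<noteq> name t"
  shows "part_of S {a. succs a t \<noteq> {}} (mu_model (name t) M) t"
proof -
  let ?L = "mu_model (name t) M"
  obtain Z where Z: "represents (insert t S) M Z"
    "\<And>a. succs a t \<noteq> {} \<Longrightarrow> matches (insert t S) Z (osucc M a (oact M)) a t"
    using M unfolding part_of_def successors_match_def by blast
  \<comment> \<open>By \<open>det\<close> only the second alternative of \<open>matches\<close> is
    left, which does not mention \<open>S\<close>.\<close>
  have root: "matches S Z (osucc M a (oact M)) a t" for a
  proof (cases "succs a t = {}")
    case True
    then show ?thesis using M by (auto simp: part_of_def matches_empty)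
  next
    case False
    then show ?thesis using Z(2)[of a] det[of a] unfolding matches_def by auto
  qed
  have act: "osucc ?L a (oact M) = osucc M a (oact M)" for a
    using det[of a] by (auto simp: mu_model_def)
  have sub: "matches S Z (osucc ?L a e) a u" if m: "matches (insert t S) Z (osucc M a e) a u" for a e u
  proof -
    from m consider "osucc M a e = {Inr (name t)}" "succs a t = succs a u"
      | v where "v \<in> S" "osucc M a e = {Inr (name v)}" "succs a v = succs a u"
      | A where "osucc M a e = Inl ` A" "rel_set Z A (succs a u)"
      unfolding matches_def by blast
    then show ?thesis
    proof cases
      case 1
      then have "osucc ?L a e = osucc M a (oact M)" by (simp add: mu_model_def)
      then show ?thesis using root[of a] 1(2) unfolding matches_def by simp
    next
      case 2
      then have "osucc ?L a e = {Inr (name v)}" using inj[OF 2(1)] by (simp add: mu_model_def)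
      then show ?thesis using 2 unfolding matches_def by blast
    next
      case 3
      then have "osucc ?L a e = Inl ` A" by (auto simp: mu_model_def)
      then show ?thesis using 3 unfolding matches_def by blast
    qed
  qed
  have "represents S ?L Z"
    using Z(1) sub unfolding represents_def by (simp add: mu_model_def)
  moreover have "oact ?L = oact M" by (simp add: mu_model_def)
  ultimately show ?thesis using M root act
    unfolding part_of_def successors_match_def by (auto simp: mu_model_def)
qed

text \<open>The term for \<open>t\<close> is \<open>\<mu>X\<^sub>t\<close> applied to the meet, over the clusters \<open>T\<close> that occur as sets of
  successors of \<open>t\<close>, of \<open>pre(t)|\<^sub>B L\<^sub>B(pre(u)|\<^sub>C \<alpha>\<^sub>u)\<close> with \<open>u\<close> ranging over \<open>T\<close>. Here \<open>B\<close> contains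
  the agents whose set of successors of \<open>t\<close> is \<open>T\<close>, \<open>C\<close> is the rest of the group of \<open>u\<close>, and \<open>\<alpha>\<^sub>u\<close> is
  the variable \<open>X\<^sub>u\<close> if it is bound already and the term for \<open>u\<close> otherwise.\<close>

lemma ex_term:
  assumes wf: "\<And>a. arrow N a \<subseteq> events N \<times> events N" and fin: "finite (events N)"
    and k45: "k45 N" and pre: "pre N ` events N \<subseteq> \<Phi>" and inj: "inj_on name (events N)"
  shows "S \<subseteq> events N \<Longrightarrow> t \<in> events N - S \<Longrightarrow>
    \<exists>\<alpha>. is_term \<Phi> \<alpha> \<and> fv \<alpha> \<subseteq> name ` S \<and> group_of \<alpha> = Some {a. succs a t \<noteq> {}} \<and>
      pre_of \<alpha> = Some (pre N t) \<and> part_of S {a. succs a t \<noteq> {}} (sem \<alpha>) t"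
\<comment> \<open>\<open>S\<close> holds the events whose variables may be free, to be bound further
  out. Each \<open>Mu\<close> adds its event to \<open>S\<close> for its body, so the recursion ends
  even when the arrows of \<open>N\<close> form cycles.\<close>
proof (induction "card (events N - S)" arbitrary: S t rule: less_induct)
  case less
  let ?S = "insert t S"
  have S: "?S \<subseteq> events N" and t: "t \<in> events N" using less.prems by auto
  have "events N - ?S \<subset> events N - S" using less.prems by blast
  then have smaller: "card (events N - ?S) < card (events N - S)"
    using fin by (simp add: psubset_card_mono)
  have arg: "\<exists>\<beta>. is_term \<Phi> \<beta> \<and> fv \<beta> \<subseteq> name ` ?S \<and> part_of ?S C (sem \<beta>) u"
    if u: "u \<in> events N" and C: "C \<subseteq> {a. succs a u \<noteq> {}}" for u C
  proof (cases "u \<in> ?S")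
    case True
    have "part_of ?S C (sem (Restrict (pre N u) C (Var (name u)))) u"
      using part_of_restrict_model[OF successors_match_var_model[OF True] subset_refl] by simp
    moreover have "is_term \<Phi> (Restrict (pre N u) C (Var (name u)))" using pre u by auto
    moreover have "fv (Restrict (pre N u) C (Var (name u))) \<subseteq> name ` ?S" using True by auto
    ultimately show ?thesis by blast
  next
    case False
    with less.hyps[OF smaller S] u obtain \<alpha> where \<alpha>: "is_term \<Phi> \<alpha>" "fv \<alpha> \<subseteq> name ` ?S"
      "group_of \<alpha> = Some {a. succs a u \<noteq> {}}" "part_of ?S {a. succs a u \<noteq> {}} (sem \<alpha>) u"
      by blast
    have "successors_match ?S {a. succs a u \<noteq> {}} (sem \<alpha>) u" using \<alpha>(4) by (simp add: part_of_def)
    then have "part_of ?S C (sem (Restrict (pre N u) C \<alpha>)) u"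
      using part_of_restrict_model[OF _ C] by simp
    moreover have "is_term \<Phi> (Restrict (pre N u) C \<alpha>)" using pre u \<alpha> C by auto
    moreover have "fv (Restrict (pre N u) C \<alpha>) \<subseteq> name ` ?S" using \<alpha>(2) by simp
    ultimately show ?thesis by blast
  qed
  have cluster: "\<exists>\<beta>. is_term \<Phi> \<beta> \<and> fv \<beta> \<subseteq> name ` ?S \<and> group_of \<beta> = Some {a. succs a t = T} \<and>
      pre_of \<beta> = Some (pre N t) \<and> part_of ?S {a. succs a t = T} (sem \<beta>) t"
    if T: "T \<in> range (\<lambda>a. succs a t) - {{}}" for T
  proof -
    let ?B = "{a. succs a t = T}"
    have TN: "T \<subseteq> events N" using T wf by (auto simp: succs_def)
    then obtain us where us: "set us = T" using fin finite_list finite_subset by metis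
    then obtain u us' where us': "us = u # us'" using T by (cases us) auto
    have "\<exists>\<beta>. is_term \<Phi> \<beta> \<and> fv \<beta> \<subseteq> name ` ?S \<and>
        part_of ?S ({a. succs a v \<noteq> {}} - ?B) (sem \<beta>) v" if "v \<in> T" for v
      using arg[of v "{a. succs a v \<noteq> {}} - ?B"] that TN by blast
    then obtain \<beta> where \<beta>: "\<And>v. v \<in> T \<Longrightarrow> is_term \<Phi> (\<beta> v) \<and> fv (\<beta> v) \<subseteq> name ` ?S \<and>
        part_of ?S ({a. succs a v \<noteq> {}} - ?B) (sem (\<beta> v)) v"
      by metis
    let ?\<gamma> = "Learn ?B (\<beta> u) (map \<beta> us')"
    have "succs a v = T" if "a \<in> ?B" "v \<in> insert t T" for a v
      using k45 that unfolding k45_def trans_def euclidean_def succs_def by blast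
    moreover have "part_of ?S ({a. succs a (us ! i) \<noteq> {}} - ?B) (map (sem \<circ> \<beta>) us ! i) (us ! i)"
      if "i < length us" for i
      using that us \<beta>[of "us ! i"] by auto
    ultimately have "successors_match ?S ?B (learn_model ?B (map (sem \<circ> \<beta>) us)) t"
      using us us' TN by (intro successors_match_learn_model[where us = us]) simp_all
    then have "successors_match ?S ?B (sem ?\<gamma>) t" using us' by simp
    then have "part_of ?S ?B (sem (Restrict (pre N t) ?B ?\<gamma>)) t"
      using part_of_restrict_model by simp
    moreover have "is_term \<Phi> (Restrict (pre N t) ?B ?\<gamma>)"
      using \<beta> us us' pre t by (auto split: option.splits)
    moreover have "fv (Restrict (pre N t) ?B ?\<gamma>) \<subseteq> name ` ?S" using \<beta> us us' by force
    \<comment> \<open>The group of \<open>Learn\<close> contains \<open>?B\<close> even if its first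
      argument has no group; this makes the attributes of the restricted term defined.\<close>
    moreover have "group_of (Restrict (pre N t) ?B ?\<gamma>) = Some ?B"
      "pre_of (Restrict (pre N t) ?B ?\<gamma>) = Some (pre N t)"
      by (auto split: option.splits)
    ultimately show ?thesis by blast
  qed
  \<comment> \<open>Distinct successor sets give disjoint groups, as \<open>Meet\<close> demands,
    and all parts have precondition \<open>pre N t\<close>. The empty meet is
    \<open>Test (pre N t)\<close>.\<close>
  have meet: "\<exists>\<beta>. is_term \<Phi> \<beta> \<and> fv \<beta> \<subseteq> name ` ?S \<and> group_of \<beta> = Some {a. succs a t \<in> \<T>} \<and>
      pre_of \<beta> = Some (pre N t) \<and> part_of ?S {a. succs a t \<in> \<T>} (sem \<beta>) t"
    if "finite \<T>" "\<T> \<subseteq> range (\<lambda>a. succs a t) - {{}}" for \<T>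
    using that
  proof (induction \<T>)
    case empty
    show ?case using pre t part_of_test_model by (intro exI[of _ "Test (pre N t)"]) auto
  next
    case (insert T \<T>)
    from insert.IH insert.prems obtain \<beta> where \<beta>: "is_term \<Phi> \<beta>" "fv \<beta> \<subseteq> name ` ?S"
      "group_of \<beta> = Some {a. succs a t \<in> \<T>}" "pre_of \<beta> = Some (pre N t)"
      "part_of ?S {a. succs a t \<in> \<T>} (sem \<beta>) t"
      by blast
    from cluster[of T] insert.prems obtain \<gamma> where \<gamma>: "is_term \<Phi> \<gamma>" "fv \<gamma> \<subseteq> name ` ?S"
      "group_of \<gamma> = Some {a. succs a t = T}" "pre_of \<gamma> = Some (pre N t)"
      "part_of ?S {a. succs a t = T} (sem \<gamma>) t"
      by blast
    have disj: "{a. succs a t = T} \<inter> {a. succs a t \<in> \<T>} = {}" using insert.hyps by blast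
    have un: "{a. succs a t = T} \<union> {a. succs a t \<in> \<T>} = {a. succs a t \<in> insert T \<T>}" by blast
    have "part_of ?S {a. succs a t \<in> insert T \<T>} (sem (Meet \<gamma> \<beta>)) t"
      using part_of_meet_model[OF \<gamma>(5) \<beta>(5) disj] \<beta>(3) \<gamma>(3) un by simp
    moreover have "group_of (Meet \<gamma> \<beta>) = Some {a. succs a t \<in> insert T \<T>}"
      "pre_of (Meet \<gamma> \<beta>) = Some (pre N t)"
      using \<beta>(3,4) \<gamma>(3,4) disj un by simp_all
    moreover have "fv (Meet \<gamma> \<beta>) \<subseteq> name ` ?S" using \<beta>(2) \<gamma>(2) by simp
    ultimately show ?case using \<beta>(1) \<gamma>(1) by (intro exI[of _ "Meet \<gamma> \<beta>"]) simp
  qed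
  let ?\<T> = "range (\<lambda>a. succs a t) - {{}}"
  \<comment> \<open>There may be infinitely many agents, but only finitely many successor
    sets.\<close>
  have "?\<T> \<subseteq> Pow (events N)" using wf by (auto simp: succs_def)
  then have "finite ?\<T>" using fin by (meson finite_Pow_iff finite_subset)
  moreover have "{a. succs a t \<in> ?\<T>} = {a. succs a t \<noteq> {}}" by blast
  ultimately obtain \<beta> where \<beta>: "is_term \<Phi> \<beta>" "fv \<beta> \<subseteq> name ` ?S"
    "group_of \<beta> = Some {a. succs a t \<noteq> {}}" "pre_of \<beta> = Some (pre N t)"
    "part_of ?S {a. succs a t \<noteq> {}} (sem \<beta>) t"
    using meet[of ?\<T>] by auto
  have "name v \<noteq> name t" if "v \<in> S" for v
    using inj less.prems that by (metis Diff_iff inj_on_contraD subsetD)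
  then have "part_of S {a. succs a t \<noteq> {}} (sem (Mu (name t) \<beta>)) t"
    using part_of_mu_model[OF \<beta>(5) osucc_oact_range_Inl[OF \<beta>(1)]] \<beta>(4) by simp
  then show ?case using \<beta> by (intro exI[of _ "Mu (name t) \<beta>"]) auto
qed

lemma bisimilar_close:
  assumes M: "part_of {} {a. succs a t \<noteq> {}} M t" and t: "t \<in> events N" and act: "oact M \<in> oevents M"
  shows "bisimilar (N, t) (close M, oact M)"
proof -
  obtain Z where Z: "represents {} M Z"
    "\<And>a. succs a t \<noteq> {} \<Longrightarrow> matches {} Z (osucc M a (oact M)) a t"
    using M unfolding part_of_def successors_match_def by blast
  \<comment> \<open>For empty \<open>S\<close> all matched sets are determinate. The pair of actual
    events is added by hand; its successors already match through \<open>Z\<close>.\<close>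
  define Z' where "Z' = (\<lambda>u e. Z e u \<or> (u = t \<and> e = oact M))"
  have root: "matches {} Z (osucc M a (oact M)) a t" for a
    using Z(2)[of a] M by (cases "succs a t = {}") (auto simp: part_of_def matches_empty)
  have *: "e \<in> oevents M \<and> u \<in> events N \<and> opre M e = Inl (pre N u) \<and>
      matches {} Z (osucc M a e) a u" if "Z' u e" for u e a
    using that Z(1) root M act t unfolding Z'_def represents_def part_of_def by auto
  have "rel_set Z' (arrow N a `` {u}) (arrow (close M) a `` {e})" if z: "Z' u e" for u e a
  proof -
    obtain A where A: "osucc M a e = Inl ` A" "rel_set Z A (succs a u)"
      using *[OF z, of a] unfolding matches_def by blast
    have "arrow (close M) a `` {e} = A" using A(1) *[OF z] by (auto simp: close_def)
    then show ?thesis using A(2) unfolding rel_set_def Z'_def succs_def by blast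
  qed
  then have "bisimulation N (close M) Z'"
    unfolding bisimulation_def using * by (fastforce simp: close_def kd45_equiv_refl)
  then show ?thesis unfolding bisimilar_def Z'_def by auto
qed

end

theorem theorem4p12:
  fixes \<Phi> :: "('p, 'a) fm set"
  shows "(\<forall>(N :: ('p, 'a, 'e) amodel) t. (N, t) \<in> FAct \<Phi> \<longrightarrow>
            (\<exists>\<alpha>\<in>RLP \<Phi>. bisimilar (N, t) (assoc_model \<alpha>))) \<and>
         (\<forall>\<alpha>\<in>RLP \<Phi>. assoc_model \<alpha> \<in> FAct \<Phi>)"
proof (intro conjI allI ballI impI)
  fix N :: "('p, 'a, 'e) amodel" and t
  assume "(N, t) \<in> FAct \<Phi>"
  then have N: "\<And>a. arrow N a \<subseteq> events N \<times> events N" "finite (events N)" "k45 N"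
    "pre N ` events N \<subseteq> \<Phi>" and t: "t \<in> events N"
    by (auto simp: FAct_def)
  \<comment> \<open>Variables are natural numbers, and finiteness lets events of any type be
    numbered injectively.\<close>
  have "inj_on (to_nat_on (events N)) (events N)"
    using N(2) by (simp add: countable_finite inj_on_to_nat_on)
  from named_events.ex_term[OF N this, of "{}" t] t obtain \<alpha>
    where \<alpha>: "is_term \<Phi> \<alpha>" "fv \<alpha> = {}" and part:
      "named_events.part_of N (to_nat_on (events N)) {} {a. named_events.succs N a t \<noteq> {}} (sem \<alpha>) t"
    by auto
  have "bisimilar (N, t) (assoc_model \<alpha>)"
    using named_events.bisimilar_close[OF part t oact_oevents[OF \<alpha>(1)]] by (simp add: assoc_model_def)
  then show "\<exists>\<alpha>\<in>RLP \<Phi>. bisimilar (N, t) (assoc_model \<alpha>)" using \<alpha> by (auto simp: RLP_def)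
next
  show "\<And>\<alpha>. \<alpha> \<in> RLP \<Phi> \<Longrightarrow> assoc_model \<alpha> \<in> FAct \<Phi>" by (rule assoc_model_in_FAct)
qed

end
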